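(* Let $(\alpha_n)_{n\ge 0}$, $(\beta_n)_{n\ge 0}$, $(\gamma_n)_{n\ge 0}$ and $(g_n)_{n\ge 0}$ be sequences of nonnegative real numbers and let $(h_n)_{n\ge 0}$ be a sequence of real numbers such that for all $n\ge 0$ $$h_n>0,\qquad 0<h_n\gamma_n<1,$$ and $$\frac{g_{n+1}-g_n}{h_n}\le -\gamma_n g_n+\alpha_n g_n^2+\beta_n$$ (equivalently, $g_{n+1}\le g_n(1-h_n\gamma_n)+\alpha_n h_n g_n^2+h_n\beta_n$). Suppose there is a monotonically growing sequence $(\mu_n)_{n\ge 0}$ of positive real numbers (that is, $\mu_n>0$ and $\mu_n\le\mu_{n+1}$ for all $n\ge 0$) such that $$g_0\le\frac{1}{\mu_0},$$ and, for all $n\ge 0$, $$\alpha_n\le\frac{\mu_n}{2}\left(\gamma_n-\frac{\mu_{n+1}-\mu_n}{\mu_n h_n}\right),\qquad \beta_n\le\frac{1}{2\mu_n}\left(\gamma_n-\frac{\mu_{n+1}-\mu_n}{\mu_n h_n}\right).$$ Then $$g_n\le\frac{1}{\mu_n}\qquad\text{for all } n\ge 0.$$ Therefore, if $\lim_{n\to\infty}\mu_n=\infty$, then $\lim_{n\to\infty}g_n=0$. *)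

theory Defs
  imports Complex_Main
begin

end

theory Submission
  imports Defs
begin

text \<open>
  Since \<open>h n * \<gamma> n < 1\<close>, the upper bound on \<open>g (n + 1)\<close> given by the recursion
  is increasing in \<open>g n \<ge> 0\<close>, so \<open>g n\<close> may be replaced by \<open>1 / \<mu> n\<close>.
  The bounds on \<open>\<alpha>\<close> and \<open>\<beta>\<close> then make it collapse to \<open>(2 * \<mu> n - \<mu> (n + 1)) / (\<mu> n)\<^sup>2\<close>,
  which is at most \<open>1 / \<mu> (n + 1)\<close> because \<open>(\<mu> n - \<mu> (n + 1))\<^sup>2 \<ge> 0\<close>.
\<close>

lemma riccati_step:
  fixes a b c x x' h m m' :: real
  assumes "0 \<le> a" "0 \<le> x" "0 < h" "h * c < 1" "0 < m" "0 < m'"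
    and step: "(x' - x) / h \<le> - c * x + a * x\<^sup>2 + b"
    and a: "a \<le> m / 2 * (c - (m' - m) / (m * h))"
    and b: "b \<le> 1 / (2 * m) * (c - (m' - m) / (m * h))"
    and x: "x \<le> 1 / m"
  shows "x' \<le> 1 / m'"
proof -
  define d where "d = c - (m' - m) / (m * h)"
  have "x' - x \<le> (- c * x + a * x\<^sup>2 + b) * h"
    using step \<open>0 < h\<close> by (simp add: pos_divide_le_eq)
  then have "x' \<le> (1 - h * c) * x + h * (a * x\<^sup>2) + h * b"
    by (simp add: algebra_simps)
  also have "\<dots> \<le> (1 - h * c) * (1 / m) + h * (m / 2 * d * (1 / m)\<^sup>2) + h * (1 / (2 * m) * d)"
  proof (intro add_mono mult_left_mono)
    \<comment> \<open>\<open>x\<close> is raised to \<open>1 / m\<close> first, using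
      \<open>0 \<le> a\<close>, and \<open>a\<close> to its bound only afterwards, so each factor
      multiplied through is visibly nonnegative.\<close>
    have "a * x\<^sup>2 \<le> a * (1 / m)\<^sup>2"
      using assms by (intro mult_left_mono power_mono) auto
    also have "\<dots> \<le> m / 2 * d * (1 / m)\<^sup>2"
      using a by (intro mult_right_mono) (auto simp: d_def)
    finally show "a * x\<^sup>2 \<le> m / 2 * d * (1 / m)\<^sup>2" .
  qed (use assms in \<open>auto simp: d_def\<close>)
  \<comment> \<open>The last two terms are each \<open>h * d / (2 * m)\<close>. Their sum
    \<open>h * d / m\<close> cancels \<open>- h * c / m\<close> and leaves
    \<open>1 / m - (m' - m) / m\<^sup>2\<close>.\<close>
  also have "\<dots> = (2 * m - m') / m\<^sup>2"
    using \<open>0 < h\<close> \<open>0 < m\<close> by (simp add: d_def field_simps power2_eq_square)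
  also have "\<dots> \<le> 1 / m'"
  proof -
    have "(2 * m - m') * m' \<le> m\<^sup>2"
      using zero_le_power2[of "m - m'"] by (simp add: power2_eq_square algebra_simps)
    then show ?thesis
      using \<open>0 < m\<close> \<open>0 < m'\<close> by (simp add: field_simps)
  qed
  finally show ?thesis .
qed

theorem theorem2:
  fixes \<alpha> \<beta> \<gamma> g h \<mu> :: "nat \<Rightarrow> real"
  assumes "\<And>n. \<alpha> n \<ge> 0" and "\<And>n. \<beta> n \<ge> 0" and "\<And>n. \<gamma> n \<ge> 0" and "\<And>n. g n \<ge> 0"
    and "\<And>n. h n > 0"
    and "\<And>n. 0 < h n * \<gamma> n" and "\<And>n. h n * \<gamma> n < 1"
    and "\<And>n. (g (n + 1) - g n) / h n \<le> - \<gamma> n * g n + \<alpha> n * (g n)\<^sup>2 + \<beta> n"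
    and "\<And>n. \<mu> n > 0" and "\<And>n. \<mu> n \<le> \<mu> (n + 1)"
    and "g 0 \<le> 1 / \<mu> 0"
    and "\<And>n. \<alpha> n \<le> \<mu> n / 2 * (\<gamma> n - (\<mu> (n + 1) - \<mu> n) / (\<mu> n * h n))"
    and "\<And>n. \<beta> n \<le> 1 / (2 * \<mu> n) * (\<gamma> n - (\<mu> (n + 1) - \<mu> n) / (\<mu> n * h n))"
  shows "(\<forall>n. g n \<le> 1 / \<mu> n) \<and> (filterlim \<mu> at_top sequentially \<longrightarrow> g \<longlonglongrightarrow> 0)"
proof -
  have bound: "g n \<le> 1 / \<mu> n" for n
  proof (induction n)
    case (Suc n)
    then show ?case
      \<comment> \<open>The second \<open>assms(9)\<close> gives positivity of \<open>m'\<close>,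
        here \<open>\<mu> (n + 1)\<close>.\<close>
      using riccati_step[OF assms(1)[of n] assms(4,5,7,9) assms(9)[of "n + 1"] assms(8,12,13)]
      by simp
  qed (use assms(11) in simp)
  moreover have "g \<longlonglongrightarrow> 0" if "filterlim \<mu> at_top sequentially"
  proof (rule tendsto_sandwich[where f = "\<lambda>_. 0"])
    show "(\<lambda>n. 1 / \<mu> n) \<longlonglongrightarrow> 0"
      using tendsto_inverse_0_at_top[OF that] by (simp add: inverse_eq_divide)
  qed (use assms(4) bound in auto)
  ultimately show ?thesis
    by blast
qed

end
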